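(* For every positive integer $m$ and every $x\in[0,1]$, $$\sum_{n=1}^\infty\frac{\zeta_n^\star(1_m;x)}{n4^n}\binom{2n}{n}=-2^{m+1}\zeta(\overline{m+1})+2^{m+1}\operatorname{Li}_{m+1}\bigl(-\sqrt{1-x}\bigr).$$
   Context: $1_m$ denotes the sequence of $m$ ones. Parametric multiple harmonic star sum: $\zeta_n^\star(k_1,\ldots,k_r;x)=\sum_{n\ge n_1\ge\cdots\ge n_r\ge1}\frac{x^{n_r}}{n_1^{k_1}\cdots n_r^{k_r}}$. The polylogarithm is $\operatorname{Li}_{s}(z)=\sum_{n\ge1}\frac{z^n}{n^s}$, and $\zeta(\overline{m+1})=\operatorname{Li}_{m+1}(-1)=\sum_{n\ge1}\frac{(-1)^n}{n^{m+1}}$. *)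

theory Defs
  imports "HOL-Analysis.Analysis"
begin

definition star_indices :: "nat \<Rightarrow> nat \<Rightarrow> nat list set" where
  "star_indices n r = {ns. length ns = r \<and> sorted_wrt (\<ge>) ns \<and> set ns \<subseteq> {1..n}}"

lemma finite_star_indices: "finite (star_indices n r)"
  by (rule finite_subset[OF _ finite_lists_length_eq[of "{1..n}" r]])
     (auto simp: star_indices_def)

(* Lists are indexed from 0, so ns ! i is the paper's n_(i+1) and last ns is n_r.
   Meaningful only for a nonempty exponent list, since last [] is unspecified. *)
definition zeta_star :: "nat \<Rightarrow> nat list \<Rightarrow> real \<Rightarrow> real" where
  "zeta_star n ks x =
     (\<Sum>ns\<in>star_indices n (length ks). x ^ last ns / (\<Prod>i<length ks. real (ns ! i) ^ (ks ! i)))"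

(* Defined by the series alone, without analytic continuation; for natural s \<ge> 2 it
   converges absolutely on the closed unit disc. *)
definition polylog :: "nat \<Rightarrow> 'a::{real_normed_field, banach} \<Rightarrow> 'a" where
  "polylog s z = (\<Sum>n. z ^ Suc n / of_nat (Suc n) ^ s)"

definition zeta_bar :: "nat \<Rightarrow> real" where
  "zeta_bar s = polylog s (-1)"

end

theory Submission
  imports Defs
begin

text \<open>
  Write \<open>S\<^sub>m(n; x)\<close> for the star sum with \<open>m\<close> unit exponents, where \<open>S\<^sub>0(n; x) = x\<^sup>n\<close>. It satisfies
  \<open>S\<^sub>m\<^sub>+\<^sub>1(n; x) = (\<Sum>j=1..n. S\<^sub>m(j; x) / j)\<close>, and starting from the finite geometric series one finds by
  induction (\<open>DERIV_star_sum\<close>) that the derivative of \<open>S\<^sub>m\<^sub>+\<^sub>1(n; x)\<close> is \<open>(S\<^sub>m(n; 1) - S\<^sub>m(n; x)) / (1 - x)\<close>.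

  The relation is linear in the star sums and its factor \<open>1 / (1 - x)\<close> does not depend on \<open>n\<close>, so it
  survives summation against the weights of the theorem: if
  \<open>F\<^sub>m(x)\<close> is the sum over \<open>n \<ge> 1\<close> of \<open>S\<^sub>m(n; x)\<close> times \<open>binomial(2n, n) / (n 4\<^sup>n)\<close>, then
  \<open>F\<^sub>m\<^sub>+\<^sub>1\<close> has the derivative \<open>(F\<^sub>m(1) - F\<^sub>m(x)) / (1 - x)\<close> on the open unit interval
  (\<open>DERIV_star_series_Suc\<close>). On the other side, \<open>Li\<^sub>s\<^sub>+\<^sub>1(- sqrt (1 - x))\<close> has the derivative
  \<open>- Li\<^sub>s(- sqrt (1 - x)) / (2 (1 - x))\<close>. Hence the formula
  \<open>F\<^sub>m(1) - F\<^sub>m(x) = - 2\<^sup>m\<^sup>+\<^sup>1 Li\<^sub>m\<^sub>+\<^sub>1(- sqrt (1 - x))\<close> propagates from \<open>m\<close> to \<open>m + 1\<close>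
  (\<open>star_series_diff\<close>). For \<open>m = 0\<close> it says
  \<open>F\<^sub>0(1) - F\<^sub>0(x) = 2 ln (1 + sqrt (1 - x))\<close>, which comes from the generating function
  \<open>1 / sqrt (1 - x)\<close> of the central binomial coefficients.

  Both sides are continuous up to the end points, because the weights are of order \<open>n\<^bsup>-3/2\<^esup>\<close> and
  \<open>S\<^sub>m(n; 1)\<close> grows at most like \<open>n\<^bsup>1/4\<^esup>\<close>. The constant of integration is determined at \<open>x = 0\<close>, where
  \<open>F\<^sub>m\<close> vanishes for \<open>m \<ge> 1\<close>; this produces the term with \<open>zeta_bar\<close>.
\<close>

section \<open>Star sums with unit exponents as iterated sums\<close>

fun star_sum :: "nat \<Rightarrow> nat \<Rightarrow> real \<Rightarrow> real" where
  "star_sum 0 n x = x ^ n"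
| "star_sum (Suc m) n x = (\<Sum>j=1..n. star_sum m j x / real j)"

text \<open>Splitting off the largest index \<open>n\<^sub>1 = j\<close> leaves a chain of
  indices bounded by \<open>j\<close>, so the star sum becomes an iterated sum.\<close>

lemma star_indices_Suc:
  "star_indices n (Suc r) = (\<lambda>(j, ns). j # ns) ` (SIGMA j:{1..n}. star_indices j r)"
  (is "?L = ?R")
proof
  show "?L \<subseteq> ?R"
  proof
    fix ns assume "ns \<in> ?L"
    then obtain j js where "ns = j # js" "length js = r" "sorted_wrt (\<ge>) (j # js)"
        "set (j # js) \<subseteq> {1..n}"
      by (cases ns) (auto simp: star_indices_def)
    moreover from this have "js \<in> star_indices j r"
      by (auto simp: star_indices_def)
    ultimately show "ns \<in> ?R" by force
  qed
  show "?R \<subseteq> ?L"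
    by (force simp: star_indices_def)
qed

lemma zeta_star_Cons:
  assumes "ks \<noteq> []"
  shows "zeta_star n (k # ks) x = (\<Sum>j=1..n. zeta_star j ks x / real j ^ k)"
proof -
  have nonempty: "ns \<noteq> []" if "ns \<in> star_indices j (length ks)" for j ns
    using that assms by (auto simp: star_indices_def)
  have "zeta_star n (k # ks) x =
      (\<Sum>(j, ns)\<in>(SIGMA j:{1..n}. star_indices j (length ks)).
         x ^ last (j # ns) / (\<Prod>i<Suc (length ks). real ((j # ns) ! i) ^ ((k # ks) ! i)))"
    unfolding zeta_star_def length_Cons star_indices_Suc
    by (subst sum.reindex) (auto simp: inj_on_def case_prod_unfold)
  also have "\<dots> = (\<Sum>(j, ns)\<in>(SIGMA j:{1..n}. star_indices j (length ks)).
         x ^ last ns / (\<Prod>i<length ks. real (ns ! i) ^ (ks ! i)) / real j ^ k)"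
    by (intro sum.cong refl, unfold prod.lessThan_Suc_shift)
       (auto dest: nonempty)
  also have "\<dots> = (\<Sum>j=1..n. zeta_star j ks x / real j ^ k)"
    by (subst sum.Sigma [symmetric])
       (auto simp: finite_star_indices zeta_star_def sum_divide_distrib)
  finally show ?thesis .
qed

lemma zeta_star_singleton: "zeta_star n [k] x = (\<Sum>j=1..n. x ^ j / real j ^ k)"
proof -
  have "star_indices n 1 = (\<lambda>j. [j]) ` {1..n}"
    by (force simp: star_indices_def length_Suc_conv)
  then show ?thesis
    by (simp add: zeta_star_def sum.reindex inj_on_def)
qed

lemma zeta_star_ones: "zeta_star n (replicate (Suc m) 1) x = star_sum (Suc m) n x"
proof (induction m arbitrary: n)
  case 0
  show ?case by (simp add: zeta_star_singleton)
next
  case (Suc m)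
  have "zeta_star n (replicate (Suc (Suc m)) 1) x = zeta_star n (1 # replicate (Suc m) 1) x"
    by simp
  also have "\<dots> = star_sum (Suc (Suc m)) n x"
    by (subst zeta_star_Cons) (simp_all only: Suc.IH star_sum.simps power_one_right, simp)
  finally show ?case .
qed

lemma star_sum_Suc_0: "star_sum (Suc m) n 0 = 0"
  by (induction m arbitrary: n) (auto intro!: sum.neutral)

lemma star_sum_mono:
  assumes "0 \<le> x" "x \<le> 1"
  shows "0 \<le> star_sum m n x" "star_sum m n x \<le> star_sum m n 1"
proof -
  show "0 \<le> star_sum m n x"
    using assms by (induction m arbitrary: n) (auto intro!: sum_nonneg)
  show "star_sum m n x \<le> star_sum m n 1"
    using assms by (induction m arbitrary: n)
      (auto intro!: sum_mono divide_right_mono simp: power_le_one)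
qed

text \<open>The driving identity. For \<open>m = 0\<close> it is the finite geometric series, and dividing by
  \<open>j\<close> and summing over \<open>j \<le> n\<close> carries it from one depth to the next.\<close>

lemma DERIV_star_sum:
  assumes "x < 1"
  shows "(star_sum (Suc m) n has_field_derivative
           (star_sum m n 1 - star_sum m n x) / (1 - x)) (at x)"
proof (induction m arbitrary: n)
  case 0
  have "((\<lambda>x. \<Sum>j=1..n. x ^ j / real j) has_field_derivative (\<Sum>j=1..n. x ^ (j - 1))) (at x)"
    by (rule DERIV_sum) (auto intro!: derivative_eq_intros)
  also have "(\<Sum>j=1..n. x ^ (j - 1)) = (\<Sum>i<n. x ^ i)"
    by (rule sum.reindex_bij_witness [of _ Suc "\<lambda>j. j - 1"]) auto
  also have "\<dots> = (1 - x ^ n) / (1 - x)"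
    using assms by (simp add: sum_gp_strict)
  moreover have "star_sum (Suc 0) n = (\<lambda>x. \<Sum>j=1..n. x ^ j / real j)"
    by (rule ext) simp
  ultimately show ?case by simp
next
  case (Suc m)
  have "((\<lambda>x. \<Sum>j=1..n. star_sum (Suc m) j x / real j) has_field_derivative
      (\<Sum>j=1..n. (star_sum m j 1 - star_sum m j x) / (1 - x) / real j)) (at x)"
    by (intro DERIV_sum DERIV_cdivide Suc.IH)
  also have "(\<Sum>j=1..n. (star_sum m j 1 - star_sum m j x) / (1 - x) / real j) =
      (star_sum (Suc m) n 1 - star_sum (Suc m) n x) / (1 - x)"
    by (simp add: diff_divide_distrib sum_subtractf sum_divide_distrib mult.commute)
  moreover have "star_sum (Suc (Suc m)) n = (\<lambda>x. \<Sum>j=1..n. star_sum (Suc m) j x / real j)"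
    by (rule ext) simp
  ultimately show ?case by simp
qed

section \<open>Growth of the star sums\<close>

text \<open>A discrete form of \<open>\<integral> t\<^bsup>-3/4\<^esup> dt = 4 t\<^bsup>1/4\<^esup>\<close>. With \<open>a\<close> and \<open>b\<close> the fourth roots of \<open>n + 1\<close>
  and \<open>n\<close>, the induction step is the inequality \<open>4 a\<^sup>3 b \<le> 3 a\<^sup>4 + b\<^sup>4\<close> of arithmetic and geometric means.\<close>

lemma sum_powr_le: "(\<Sum>j=1..n. real j powr (- 3 / 4)) \<le> 4 * real n powr (1 / 4)"
proof (induction n)
  case (Suc n)
  define a b where "a = real (Suc n) powr (1 / 4)" and "b = real n powr (1 / 4)"
  have pos: "a > 0" "b \<ge> 0" by (auto simp: a_def b_def)
  have a4: "a ^ 4 = real n + 1" and b4: "b ^ 4 = real n"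
    by (cases "n = 0"; simp add: a_def b_def powr_power)+
  have a3: "real (Suc n) powr (- 3 / 4) = 1 / a ^ 3"
    by (simp add: a_def powr_power powr_minus_divide [symmetric])
  have "0 \<le> (a - b)\<^sup>2 * (3 * a\<^sup>2 + 2 * a * b + b\<^sup>2)"
    using pos by (intro mult_nonneg_nonneg add_nonneg_nonneg) auto
  also have "\<dots> = 3 * a ^ 4 + b ^ 4 - 4 * a ^ 3 * b"
    by (simp add: power2_eq_square eval_nat_numeral algebra_simps)
  finally have "4 * b * a ^ 3 + 1 \<le> 4 * a ^ 4"
    using a4 b4 by (simp add: algebra_simps)
  then have "4 * b + 1 / a ^ 3 \<le> 4 * a"
    using pos by (simp add: field_simps eval_nat_numeral)
  then have "4 * b + real (Suc n) powr (- 3 / 4) \<le> 4 * a"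
    by (simp only: a3)
  then show ?case
    using Suc.IH by (simp add: a_def b_def)
qed simp

text \<open>The true growth is a power of \<open>ln n\<close>. Any exponent below \<open>1/2\<close> is enough against
  weights of order \<open>n\<^bsup>-3/2\<^esup>\<close>, and a fixed power of \<open>n\<close> reproduces itself under summation with \<open>1/j\<close>.\<close>

lemma star_sum_one_le:
  assumes "n \<ge> 1"
  shows "star_sum m n 1 \<le> 4 ^ m * real n powr (1 / 4)"
  using assms
proof (induction m arbitrary: n)
  case 0
  then show ?case by (simp add: ge_one_powr_ge_zero)
next
  case (Suc m)
  have "star_sum (Suc m) n 1 \<le> (\<Sum>j=1..n. 4 ^ m * real j powr (- 3 / 4))"
  proof (unfold star_sum.simps, rule sum_mono)
    fix j assume j: "j \<in> {1..n}"
    then have "star_sum m j 1 / real j \<le> 4 ^ m * real j powr (1 / 4) / real j"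
      by (intro divide_right_mono Suc.IH) auto
    also have "\<dots> = 4 ^ m * real j powr (1 / 4 - 1)"
      using j by (simp only: powr_diff) simp
    finally show "star_sum m j 1 / real j \<le> 4 ^ m * real j powr (- 3 / 4)" by simp
  qed
  also have "\<dots> \<le> 4 ^ m * (4 * real n powr (1 / 4))"
    unfolding sum_distrib_left [symmetric] by (intro mult_left_mono sum_powr_le) auto
  finally show ?case by simp
qed

declare star_sum.simps(2) [simp del]

section \<open>Normalized central binomial coefficients\<close>

definition cbinom :: "nat \<Rightarrow> real" where
  "cbinom n = real ((2 * n) choose n) / 4 ^ n"

lemma cbinom_Suc: "cbinom (Suc n) = (2 * real n + 1) / (2 * real n + 2) * cbinom n"
proof -
  have "cbinom k = fact (2 * k) / (fact k * fact k * 4 ^ k)" for k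
    by (simp add: cbinom_def binomial_fact mult_2)
  moreover have "(fact (2 * Suc n) :: real) = (2 * real n + 2) * (2 * real n + 1) * fact (2 * n)"
    by (simp add: algebra_simps)
  moreover have "(fact (Suc n) :: real) = (real n + 1) * fact n"
    by simp
  ultimately show ?thesis
    by (simp only: power_Suc) (simp add: divide_simps, simp add: algebra_simps)
qed

lemma cbinom_pos: "cbinom n > 0"
  by (simp add: cbinom_def)

text \<open>Squaring makes the bound provable by induction: the ratio of consecutive terms is
  rational, and \<open>(2n + 1)\<^sup>2 (n + 2) \<le> (2n + 2)\<^sup>2 (n + 1)\<close>.\<close>

lemma cbinom_le: "cbinom n \<le> 1 / sqrt (real n + 1)"
proof -
  have "(cbinom n)\<^sup>2 * (real n + 1) \<le> 1"
  proof (induction n)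
    case 0
    show ?case by (simp add: cbinom_def)
  next
    case (Suc n)
    have "((2 * real n + 1) / (2 * real n + 2))\<^sup>2 * (real n + 2) \<le> real n + 1"
      by (simp add: power_divide divide_simps) (simp add: power2_eq_square algebra_simps)
    then have "((2 * real n + 1) / (2 * real n + 2))\<^sup>2 * (real n + 2) * (cbinom n)\<^sup>2
        \<le> (real n + 1) * (cbinom n)\<^sup>2"
      by (rule mult_right_mono) simp
    also have "\<dots> \<le> 1"
      using Suc.IH by (simp add: mult.commute)
    finally show ?case
      by (simp only: cbinom_Suc power_mult_distrib) (simp add: mult_ac add.commute)
  qed
  then have "(cbinom n)\<^sup>2 \<le> (1 / sqrt (real n + 1))\<^sup>2"
    by (simp add: power_divide field_simps)
  then show ?thesis
    by (rule power2_le_imp_le) simp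
qed

lemma cbinom_gbinomial: "cbinom n = (- 1 / 2 gchoose n) * (- 1) ^ n"
proof (induction n)
  case 0
  show ?case by (simp add: cbinom_def)
next
  case (Suc n)
  have "(- 1 / 2 gchoose Suc n) = (- 1 / 2 gchoose n) * (- (2 * real n + 1) / (2 * real n + 2))"
    using gbinomial_mult_1 [of "- 1 / 2 :: real" n]
    by (simp add: field_simps)
  then show ?case
    by (simp add: cbinom_Suc Suc.IH minus_divide_left [symmetric] del: minus_add_distrib)
qed

lemma cbinom_sums:
  assumes "\<bar>x\<bar> < 1"
  shows "(\<lambda>n. cbinom n * x ^ n) sums (1 / sqrt (1 - x))"
proof -
  have "(\<lambda>n. (- 1 / 2 gchoose n) * (- x) ^ n) sums (1 + (- x)) powr (- 1 / 2)"
    by (rule gen_binomial_real) (use assms in auto)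
  moreover have "(- 1 / 2 gchoose n) * (- x) ^ n = cbinom n * x ^ n" for n
    by (subst power_minus) (simp add: cbinom_gbinomial)
  moreover have "(1 + (- x)) powr (- 1 / 2) = 1 / sqrt (1 - x)"
    using assms by (simp add: powr_minus_divide powr_half_sqrt [symmetric])
  ultimately show ?thesis by simp
qed

section \<open>Dominated series of functions\<close>

lemma continuous_on_suminf_bounded:
  fixes f :: "nat \<Rightarrow> real \<Rightarrow> real"
  assumes "\<And>n. continuous_on S (f n)"
    and "\<And>n x. x \<in> S \<Longrightarrow> \<bar>f n x\<bar> \<le> M n" and "summable M"
  shows "continuous_on S (\<lambda>x. \<Sum>n. f n x)"
proof (rule uniform_limit_theorem [OF _ _ trivial_limit_sequentially])
  show "uniform_limit S (\<lambda>n x. \<Sum>i<n. f i x) (\<lambda>x. \<Sum>i. f i x) sequentially"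
    by (rule Weierstrass_m_test) (use assms in auto)
  show "\<forall>\<^sub>F n in sequentially. continuous_on S (\<lambda>x. \<Sum>i<n. f i x)"
    using assms(1) by (auto intro!: always_eventually continuous_on_sum)
qed

text \<open>The bound on the derivatives is only required on a compact interval around the point,
  since the series below have derivatives that blow up at an end of their interval of convergence.\<close>

lemma DERIV_suminf_bounded:
  fixes f f' :: "nat \<Rightarrow> real \<Rightarrow> real"
  assumes x: "a < x" "x < b"
    and "\<And>n t. a \<le> t \<Longrightarrow> t \<le> b \<Longrightarrow> (f n has_field_derivative f' n t) (at t)"
    and "\<And>n t. a \<le> t \<Longrightarrow> t \<le> b \<Longrightarrow> \<bar>f' n t\<bar> \<le> M n" and "summable M"
    and "summable (\<lambda>n. f n x)"
  shows "((\<lambda>x. \<Sum>n. f n x) has_field_derivative (\<Sum>n. f' n x)) (at x)"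
proof (rule has_field_derivative_series'(2) [where S = "{a..b}" and x0 = x])
  show "uniformly_convergent_on {a..b} (\<lambda>n t. \<Sum>i<n. f' i t)"
    by (rule Weierstrass_m_test') (use assms in auto)
qed (use assms in \<open>auto intro: has_field_derivative_at_within\<close>)

section \<open>The real polylogarithm\<close>

text \<open>Termwise differentiation, dominated by a geometric series near \<open>z\<close>. The domination is the
  same for every \<open>s\<close>, so \<open>s = 0\<close> and \<open>s = 1\<close>, where the series fails at an end point, are covered.\<close>

lemma DERIV_polylog:
  assumes "z \<noteq> 0" "\<bar>z\<bar> < 1"
  shows "(polylog (Suc s) has_field_derivative polylog s z / z) (at (z::real))"
proof -
  obtain r where r: "\<bar>z\<bar> < r" "r < 1" using assms(2) dense by blast
  have geo: "summable (\<lambda>n. r ^ n)"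
    using r by (intro summable_geometric) auto
  have bound: "\<bar>t ^ n / real (Suc n) ^ j\<bar> \<le> r ^ n" if "\<bar>t\<bar> \<le> r" for t n j
  proof -
    have "\<bar>t ^ n / real (Suc n) ^ j\<bar> \<le> \<bar>t\<bar> ^ n / 1"
      unfolding abs_divide power_abs by (intro divide_left_mono) auto
    also have "\<dots> \<le> r ^ n"
      using that by (simp add: power_mono)
    finally show ?thesis .
  qed
  have summ: "summable (\<lambda>n. z ^ n / real (Suc n) ^ j)" for j
    by (rule summable_comparison_test' [OF geo, of 0]) (use r bound in auto)
  have "((\<lambda>z. \<Sum>n. z ^ Suc n / real (Suc n) ^ Suc s) has_field_derivative
          (\<Sum>n. z ^ n / real (Suc n) ^ s)) (at z)"
  proof (rule DERIV_suminf_bounded [where a = "-r" and b = r and M = "\<lambda>n. r ^ n"])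
    fix n t
    have "((\<lambda>z. z ^ Suc n / real (Suc n) ^ Suc s) has_field_derivative
            (real (Suc n) * t ^ n) / real (Suc n) ^ Suc s) (at t)"
      by (rule DERIV_cdivide) (use DERIV_pow [of "Suc n" t UNIV] in \<open>simp del: of_nat_Suc power_Suc\<close>)
    also have "(real (Suc n) * t ^ n) / real (Suc n) ^ Suc s = t ^ n / real (Suc n) ^ s"
      by (simp del: of_nat_Suc)
    finally show "((\<lambda>z. z ^ Suc n / real (Suc n) ^ Suc s) has_field_derivative
            t ^ n / real (Suc n) ^ s) (at t)" .
  next
    show "summable (\<lambda>n. z ^ Suc n / real (Suc n) ^ Suc s)"
      using summable_mult [OF summ [of "Suc s"], of z] by simp
  qed (use r geo bound in auto)
  moreover have "(\<Sum>n. z ^ n / real (Suc n) ^ s) = polylog s z / z"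
  proof -
    have "polylog s z = (\<Sum>n. z * (z ^ n / real (Suc n) ^ s))"
      by (simp add: polylog_def)
    also have "\<dots> = z * (\<Sum>n. z ^ n / real (Suc n) ^ s)"
      by (rule suminf_mult [OF summ])
    finally show ?thesis using assms by simp
  qed
  moreover have "polylog (Suc s) = (\<lambda>z::real. \<Sum>n. z ^ Suc n / real (Suc n) ^ Suc s)"
    by (simp add: fun_eq_iff polylog_def)
  ultimately show ?thesis by simp
qed

lemma continuous_on_polylog:
  assumes "s \<ge> 2"
  shows "continuous_on {-1..1::real} (polylog s)"
proof -
  have "continuous_on {-1..1::real} (\<lambda>z. \<Sum>n. z ^ Suc n / real (Suc n) ^ s)"
  proof (rule continuous_on_suminf_bounded [where M = "\<lambda>n. inverse (real (Suc n) ^ s)"])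
    fix n :: nat and z :: real
    assume z: "z \<in> {-1..1}"
    then have "\<bar>z\<bar> ^ Suc n \<le> 1" by (intro power_le_one) auto
    then show "\<bar>z ^ Suc n / real (Suc n) ^ s\<bar> \<le> inverse (real (Suc n) ^ s)"
      unfolding abs_divide power_abs by (simp add: divide_simps del: power_Suc of_nat_Suc)
  next
    show "summable (\<lambda>n. inverse (real (Suc n) ^ s))"
      using inverse_power_summable [OF assms] by (subst summable_Suc_iff)
  qed (auto intro!: continuous_intros)
  then show ?thesis
    by (simp add: polylog_def [abs_def])
qed

lemma polylog_0: "polylog s (0::real) = 0"
  by (simp add: polylog_def)

lemma polylog_1:
  assumes "\<bar>z\<bar> < 1"
  shows "polylog 1 (z::real) = - ln (1 - z)"
proof -
  have "(\<lambda>n. - (z ^ n) / real n) sums ln (1 - z)"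
    using ln_series' [of "- z"] assms by simp
  then have "(\<lambda>n. - (z ^ Suc n) / real (Suc n)) sums ln (1 - z)"
    by (subst sums_Suc_iff) simp
  then have "(\<lambda>n. z ^ Suc n / real (Suc n)) sums - ln (1 - z)"
    using sums_minus by fastforce
  then show ?thesis
    by (simp add: polylog_def sums_iff)
qed

section \<open>The weighted series of star sums\<close>

definition star_series :: "nat \<Rightarrow> real \<Rightarrow> real" where
  "star_series m x = (\<Sum>k. cbinom (Suc k) / real (Suc k) * star_sum m (Suc k) x)"

lemma summable_cbinom_star_sum:
  "summable (\<lambda>k. cbinom (Suc k) / real (Suc k) * star_sum m (Suc k) 1)"
proof (rule summable_comparison_test')
  have "summable (\<lambda>n. 4 ^ m * real n powr (- 5 / 4))"
    by (intro summable_mult) (simp add: summable_real_powr_iff)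
  then show "summable (\<lambda>k. 4 ^ m * real (Suc k) powr (- 5 / 4))"
    by (subst summable_Suc_iff)
next
  fix k :: nat
  let ?n = "real (Suc k)"
  have "cbinom (Suc k) \<le> 1 / sqrt ?n"
    using cbinom_le [of "Suc k"]
    by (rule order_trans) (simp add: frac_le)
  also have "\<dots> = ?n powr (- 1 / 2)"
    by (simp add: powr_minus_divide powr_half_sqrt [symmetric])
  finally have "cbinom (Suc k) / ?n * star_sum m (Suc k) 1
      \<le> ?n powr (- 1 / 2) / ?n * (4 ^ m * ?n powr (1 / 4))"
    by (intro mult_mono divide_right_mono star_sum_one_le star_sum_mono) auto
  also have "\<dots> = 4 ^ m * (?n powr (- 1 / 2) / ?n powr 1 * ?n powr (1 / 4))"
    by simp
  also have "\<dots> = 4 ^ m * ?n powr (- 5 / 4)"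
    unfolding powr_diff [symmetric] powr_add [symmetric] by simp
  finally show "norm (cbinom (Suc k) / ?n * star_sum m (Suc k) 1) \<le> 4 ^ m * ?n powr (- 5 / 4)"
    using cbinom_pos [of "Suc k"] star_sum_mono(1) [of 1 m "Suc k"] by simp
qed

lemma star_series_term_le:
  assumes "0 \<le> x" "x \<le> 1"
  shows "\<bar>cbinom (Suc k) / real (Suc k) * star_sum m (Suc k) x\<bar>
    \<le> cbinom (Suc k) / real (Suc k) * star_sum m (Suc k) 1"
  using star_sum_mono [OF assms, of m "Suc k"] cbinom_pos [of "Suc k"]
  by (simp add: abs_mult mult_left_mono divide_right_mono)

lemma summable_star_series:
  assumes "0 \<le> x" "x \<le> 1"
  shows "summable (\<lambda>k. cbinom (Suc k) / real (Suc k) * star_sum m (Suc k) x)"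
  by (rule summable_comparison_test' [OF summable_cbinom_star_sum, of 0])
     (use star_series_term_le [OF assms] in simp)

lemma continuous_on_star_series: "continuous_on {0..1} (star_series m)"
  unfolding star_series_def [abs_def]
proof (rule continuous_on_suminf_bounded [OF _ _ summable_cbinom_star_sum])
  have "continuous_on S (star_sum m n)" for S n
    by (induction m arbitrary: n) (auto simp: star_sum.simps(2) [abs_def] intro!: continuous_intros)
  then show "continuous_on {0..1} (\<lambda>x. cbinom (Suc k) / real (Suc k) * star_sum m (Suc k) x)" for k
    by (intro continuous_intros)
qed (use star_series_term_le in auto)

text \<open>The identity for a single star sum passes to the series because the star sum of depth
  \<open>m\<close> at \<open>t\<close> lies between \<open>0\<close> and its value at \<open>1\<close>, which is summable against the weights.\<close>

lemma DERIV_star_series_Suc: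
  assumes "0 < x" "x < 1"
  shows "(star_series (Suc m) has_field_derivative (star_series m 1 - star_series m x) / (1 - x)) (at x)"
proof -
  obtain b where b: "x < b" "b < 1" using assms(2) dense by blast
  let ?c = "\<lambda>k. cbinom (Suc k) / real (Suc k)"
  have "((\<lambda>x. \<Sum>k. ?c k * star_sum (Suc m) (Suc k) x) has_field_derivative
      (\<Sum>k. ?c k * ((star_sum m (Suc k) 1 - star_sum m (Suc k) x) / (1 - x)))) (at x)"
  proof (rule DERIV_suminf_bounded [where a = 0 and b = b
        and M = "\<lambda>k. ?c k * star_sum m (Suc k) 1 * (1 / (1 - b))"])
    fix k t assume t: "0 \<le> t" "t \<le> b"
    show "((\<lambda>x. ?c k * star_sum (Suc m) (Suc k) x) has_field_derivative
        ?c k * ((star_sum m (Suc k) 1 - star_sum m (Suc k) t) / (1 - t))) (at t)"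
      by (intro DERIV_cmult DERIV_star_sum) (use t b in auto)
    have "(star_sum m (Suc k) 1 - star_sum m (Suc k) t) / (1 - t)
        \<le> star_sum m (Suc k) 1 / (1 - b)"
      using star_sum_mono [of t m "Suc k"] t b by (intro frac_le) auto
    moreover have "0 \<le> (star_sum m (Suc k) 1 - star_sum m (Suc k) t) / (1 - t)"
      using star_sum_mono [of t m "Suc k"] t b by auto
    ultimately have "\<bar>(star_sum m (Suc k) 1 - star_sum m (Suc k) t) / (1 - t)\<bar>
        \<le> star_sum m (Suc k) 1 / (1 - b)"
      by linarith
    then have "?c k * \<bar>(star_sum m (Suc k) 1 - star_sum m (Suc k) t) / (1 - t)\<bar>
        \<le> ?c k * (star_sum m (Suc k) 1 / (1 - b))"
      using cbinom_pos [of "Suc k"] by (intro mult_left_mono) auto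
    then show "\<bar>?c k * ((star_sum m (Suc k) 1 - star_sum m (Suc k) t) / (1 - t))\<bar>
        \<le> ?c k * star_sum m (Suc k) 1 * (1 / (1 - b))"
      using cbinom_pos [of "Suc k"] by (simp add: abs_mult)
  next
    show "summable (\<lambda>k. ?c k * star_sum m (Suc k) 1 * (1 / (1 - b)))"
      by (intro summable_mult2 summable_cbinom_star_sum)
  next
    show "summable (\<lambda>k. ?c k * star_sum (Suc m) (Suc k) x)"
      using assms by (intro summable_star_series) auto
  qed (use assms b in auto)
  moreover have "(\<lambda>k. (?c k * star_sum m (Suc k) 1 - ?c k * star_sum m (Suc k) x) / (1 - x))
      sums ((star_series m 1 - star_series m x) / (1 - x))"
    unfolding star_series_def using assms
    by (intro sums_divide sums_diff summable_sums summable_star_series) auto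
  then have "(\<Sum>k. ?c k * ((star_sum m (Suc k) 1 - star_sum m (Suc k) x) / (1 - x)))
      = (star_series m 1 - star_series m x) / (1 - x)"
    by (simp add: sums_iff right_diff_distrib)
  moreover have "star_series (Suc m) = (\<lambda>x. \<Sum>k. ?c k * star_sum (Suc m) (Suc k) x)"
    by (simp add: fun_eq_iff star_series_def)
  ultimately show ?thesis by simp
qed

lemma DERIV_star_series_0:
  assumes "0 < x" "x < 1"
  shows "(star_series 0 has_field_derivative (1 / sqrt (1 - x) - 1) / x) (at x)"
proof -
  obtain b where b: "x < b" "b < 1" using assms(2) dense by blast
  have "((\<lambda>x. \<Sum>k. cbinom (Suc k) / real (Suc k) * x ^ Suc k) has_field_derivative
      (\<Sum>k. cbinom (Suc k) * x ^ k)) (at x)"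
  proof (rule DERIV_suminf_bounded [where a = 0 and b = b and M = "\<lambda>k. cbinom (Suc k) * b ^ k"])
    fix k t assume t: "0 \<le> t" "t \<le> b"
    have "((\<lambda>x. cbinom (Suc k) / real (Suc k) * x ^ Suc k) has_field_derivative
        cbinom (Suc k) / real (Suc k) * (real (Suc k) * t ^ k)) (at t)"
      by (rule DERIV_cmult) (use DERIV_pow [of "Suc k" t UNIV] in \<open>simp del: of_nat_Suc power_Suc\<close>)
    then show "((\<lambda>x. cbinom (Suc k) / real (Suc k) * x ^ Suc k) has_field_derivative
        cbinom (Suc k) * t ^ k) (at t)"
      by (simp del: of_nat_Suc)
    show "\<bar>cbinom (Suc k) * t ^ k\<bar> \<le> cbinom (Suc k) * b ^ k"
      using t cbinom_pos [of "Suc k"] by (simp add: abs_mult power_mono)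
  next
    have "summable (\<lambda>k. cbinom k * b ^ k)"
      using cbinom_sums [of b] b assms by (auto intro: sums_summable)
    then have "summable (\<lambda>k. cbinom (Suc k) * b ^ Suc k / b)"
      by (intro summable_divide) (subst summable_Suc_iff)
    then show "summable (\<lambda>k. cbinom (Suc k) * b ^ k)"
      using b assms by simp
  next
    show "summable (\<lambda>k. cbinom (Suc k) / real (Suc k) * x ^ Suc k)"
      using summable_star_series [of x 0] assms by simp
  qed (use assms b in auto)
  moreover have "(\<lambda>k. cbinom (Suc k) * x ^ Suc k) sums (1 / sqrt (1 - x) - 1)"
    using cbinom_sums [of x] assms
    by (subst sums_Suc_iff) (simp add: cbinom_def)
  then have "(\<lambda>k. cbinom (Suc k) * x ^ Suc k / x) sums ((1 / sqrt (1 - x) - 1) / x)"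
    by (rule sums_divide)
  then have "(\<Sum>k. cbinom (Suc k) * x ^ k) = (1 / sqrt (1 - x) - 1) / x"
    using assms by (simp add: sums_iff)
  moreover have "star_series 0 = (\<lambda>x. \<Sum>k. cbinom (Suc k) / real (Suc k) * x ^ Suc k)"
    by (simp add: fun_eq_iff star_series_def)
  ultimately show ?thesis by simp
qed

section \<open>Evaluation by polylogarithms\<close>

text \<open>Base case of the induction on the depth. Since \<open>t = (1 - s)(1 + s)\<close> for
  \<open>s = sqrt (1 - t)\<close>, the derivative \<open>(1/s - 1)/t\<close> equals \<open>1 / (s (1 + s))\<close>, which is minus the
  derivative of \<open>2 ln (1 + s)\<close>; the difference is fixed by its limit at \<open>t = 1\<close>.\<close>

lemma star_series_0_diff:
  assumes "0 < x" "x < 1"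
  shows "star_series 0 1 - star_series 0 x = 2 * ln (1 + sqrt (1 - x))"
proof -
  let ?h = "\<lambda>t. star_series 0 t + 2 * ln (1 + sqrt (1 - t))"
  have "?h 1 = ?h x"
  proof (rule DERIV_isconst_end [OF assms(2)])
    have "1 + sqrt (1 - t) \<noteq> 0" if "t \<le> 1" for t
      using real_sqrt_ge_zero [of "1 - t"] that by linarith
    then show "continuous_on {x..1} ?h"
      using assms by (intro continuous_intros continuous_on_subset [OF continuous_on_star_series]) auto
  next
    fix t assume t: "x < t" "t < 1"
    define s where "s = sqrt (1 - t)"
    have s: "s > 0" "s < 1" "t = (1 - s) * (1 + s)"
      using t assms by (auto simp: s_def algebra_simps)
    have "((\<lambda>t. sqrt (1 - t)) has_field_derivative - 1 / (2 * s)) (at t)"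
      using t unfolding s_def by (auto intro!: derivative_eq_intros simp: inverse_eq_divide)
    then have "((\<lambda>t. ln (1 + sqrt (1 - t))) has_field_derivative - 1 / (2 * s) / (1 + s)) (at t)"
      using s(1) t by (auto intro!: derivative_eq_intros simp: s_def [symmetric] divide_simps)
    then have "(?h has_field_derivative (1 / s - 1) / t + 2 * (- 1 / (2 * s) / (1 + s))) (at t)"
      using DERIV_star_series_0 [of t] t assms unfolding s_def
      by (intro DERIV_add DERIV_cmult) auto
    moreover have "(1 / s - 1) / t + 2 * (- 1 / (2 * s) / (1 + s)) = 0"
      using s by (simp add: divide_simps)
    ultimately show "(?h has_field_derivative 0) (at t)" by simp
  qed
  then show ?thesis by simp
qed

lemma DERIV_polylog_sqrt:
  assumes "0 < x" "x < 1"
  shows "((\<lambda>t. polylog (Suc s) (- sqrt (1 - t))) has_field_derivative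
           - polylog s (- sqrt (1 - x)) / (2 * (1 - x))) (at x)"
proof -
  have "((\<lambda>t. - sqrt (1 - t)) has_field_derivative 1 / (2 * sqrt (1 - x))) (at x)"
    using assms by (auto intro!: derivative_eq_intros simp: inverse_eq_divide)
  moreover have "(polylog (Suc s) has_field_derivative
      polylog s (- sqrt (1 - x)) / (- sqrt (1 - x))) (at (- sqrt (1 - x)))"
    by (rule DERIV_polylog) (use assms in auto)
  ultimately have "((\<lambda>t. polylog (Suc s) (- sqrt (1 - t))) has_field_derivative
      polylog s (- sqrt (1 - x)) / (- sqrt (1 - x)) * (1 / (2 * sqrt (1 - x)))) (at x)"
    by (rule DERIV_chain2 [rotated])
  moreover have "p / (- sqrt (1 - x)) * (1 / (2 * sqrt (1 - x))) = - p / (2 * (1 - x))" for p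
  proof -
    have "p / (- sqrt (1 - x)) * (1 / (2 * sqrt (1 - x))) = - p / (2 * (sqrt (1 - x) * sqrt (1 - x)))"
      by simp
    then show ?thesis using assms by simp
  qed
  ultimately show ?thesis by (simp only:)
qed

text \<open>Both sides have the same derivative on the open interval. The constant is read off at
  \<open>x = 0\<close>, where every star sum of positive depth vanishes.\<close>

lemma star_series_Suc_eq_polylog:
  assumes "\<And>x. 0 < x \<Longrightarrow> x < 1 \<Longrightarrow>
      star_series m 1 - star_series m x = - (2 ^ Suc m) * polylog (Suc m) (- sqrt (1 - x))"
    and "0 \<le> x" "x \<le> 1"
  shows "star_series (Suc m) x = 2 ^ (m + 2) * (polylog (m + 2) (- sqrt (1 - x)) - polylog (m + 2) (- 1))"
proof -
  let ?h = "\<lambda>t. star_series (Suc m) t - 2 ^ (m + 2) * polylog (m + 2) (- sqrt (1 - t))"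
  have "?h x = ?h 0"
  proof (rule DERIV_isconst2 [of 0 1])
    have "continuous_on {0..1} (\<lambda>t. polylog (m + 2) (- sqrt (1 - t)))"
    proof (rule continuous_on_compose2 [OF continuous_on_polylog])
      show "continuous_on {0..1} (\<lambda>t::real. - sqrt (1 - t))"
        by (intro continuous_intros)
      show "(\<lambda>t. - sqrt (1 - t)) ` {0..1} \<subseteq> {-1..1}"
        by (auto intro!: order_trans [of "- 1" 0 "sqrt _"])
    qed simp
    then show "continuous_on {0..1} ?h"
      by (intro continuous_on_diff continuous_on_mult_left continuous_on_star_series)
  next
    fix t :: real assume t: "0 < t" "t < 1"
    have "(?h has_field_derivative (star_series m 1 - star_series m t) / (1 - t)
        - 2 ^ (m + 2) * (- polylog (Suc m) (- sqrt (1 - t)) / (2 * (1 - t)))) (at t)"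
      using DERIV_polylog_sqrt [OF t, of "Suc m"]
      by (intro DERIV_diff DERIV_cmult DERIV_star_series_Suc t) simp
    moreover have "(star_series m 1 - star_series m t) / (1 - t)
        - 2 ^ (m + 2) * (- polylog (Suc m) (- sqrt (1 - t)) / (2 * (1 - t))) = 0"
      unfolding assms(1) [OF t] using t by (simp add: divide_simps)
    ultimately show "(?h has_field_derivative 0) (at t)"
      by (simp only:)
  qed (use assms(2,3) in auto)
  moreover have "star_series (Suc m) 0 = 0"
    by (simp add: star_series_def star_sum_Suc_0)
  ultimately show ?thesis by (simp add: algebra_simps)
qed

text \<open>The induction runs over the open interval because at depth \<open>0\<close> and \<open>x = 0\<close> the right-hand
  side is the conditionally convergent series for \<open>ln 2\<close>. The value of \<open>star_series (Suc m) 1\<close> needs no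
  separate computation: at \<open>x = 1\<close> the polylogarithm is evaluated at \<open>0\<close>.\<close>

lemma star_series_diff:
  assumes "0 < x" "x < 1"
  shows "star_series m 1 - star_series m x = - (2 ^ Suc m) * polylog (Suc m) (- sqrt (1 - x))"
  using assms
proof (induction m arbitrary: x)
  case 0
  then show ?case
    using polylog_1 [of "- sqrt (1 - x)"] by (simp add: star_series_0_diff)
next
  case (Suc m)
  note eval = star_series_Suc_eq_polylog [OF Suc.IH]
  show ?case
    using eval [of x] eval [of 1] Suc.prems by (simp add: polylog_0 algebra_simps)
qed

theorem mainTheorem7:
  fixes m :: nat and x :: real
  assumes "m \<ge> 1" and "0 \<le> x" and "x \<le> 1"
  shows "(\<lambda>k. let n = Suc k in
            zeta_star n (replicate m 1) x / (real n * 4 ^ n) * real ((2 * n) choose n))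
         sums (- (2 ^ (m + 1)) * zeta_bar (m + 1) + 2 ^ (m + 1) * polylog (m + 1) (- sqrt (1 - x)))"
proof -
  obtain l where m: "m = Suc l"
    using assms(1) by (cases m) auto
  have "(\<lambda>k. cbinom (Suc k) / real (Suc k) * star_sum m (Suc k) x) sums star_series m x"
    unfolding star_series_def using assms by (intro summable_sums summable_star_series)
  moreover have "cbinom n / real n * star_sum m n x
      = zeta_star n (replicate m 1) x / (real n * 4 ^ n) * real ((2 * n) choose n)" for n
    by (simp only: m zeta_star_ones cbinom_def) (simp add: mult.commute)
  moreover have "star_series m x
      = - (2 ^ (m + 1)) * zeta_bar (m + 1) + 2 ^ (m + 1) * polylog (m + 1) (- sqrt (1 - x))"
    unfolding m
    by (subst star_series_Suc_eq_polylog [OF star_series_diff])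
       (use assms in \<open>simp_all add: zeta_bar_def algebra_simps\<close>)
  ultimately show ?thesis
    by (simp only: Let_def)
qed

end
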